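(* The dynamic $s$-$t$-reachability query is not in unary $\mathrm{DynQF}$.
   Context: An $s$-$t$-graph is a structure over the schema with one binary relation symbol $E$ and two constants $s,t$; the $s$-$t$-reachability query is true iff there is a directed path from $s$ to $t$. Dynamic setting: schemas may contain relation, function and constant symbols. A dynamic program has a relational input schema $\tau_{in}$ and an auxiliary schema $\tau_{aux}$ that may contain relation and function symbols (no built-in data). Concrete modifications insert or delete a single tuple of an input relation (constants never modified). Update terms: every variable and constant is an update term; if $f$ is a $k$-ary function symbol and $t_1,\dots,t_k$ update terms, $f(t_1,\dots,t_k)$ is an update term; if $\phi$ is a quantifier-free formula (which may use update terms) and $t_1,t_2$ are update terms, then $\mathrm{ite}(\phi,t_1,t_2)$ is an update term, evaluating to $t_1$ if $\phi$ holds and to $t_2$ otherwise. The update program has, for every auxiliary relation symbol $R$ and abstract modification $\delta$, a quantifier-free formula $\varphi^R_\delta(\vec x;\vec y)$ (possibly using update terms), and for every auxiliary function symbol $f$ and $\delta$ an update term $t^f_\delta(\vec x;\vec y)$. After a modification $\delta(\vec a)$, the input is modified, each $R$ becomes $\{\vec b:\text{old state}\models\varphi^R_\delta(\vec a;\vec b)\}$ and each $f$ is redefined by $f(\vec b)=t^f_\delta(\vec a;\vec b)$ evaluated in the old state. A dynamic program has an arbitrary initialization mapping from input databases to auxiliary structures over the same domain and a designated query relation symbol $Q$; it maintains a query if for every input database $\mathcal D$ and every finite modification sequence $\alpha$, $Q$ after applying $\alpha$ to the initial state equals the query answer on $\alpha(\mathcal D)$. $\mathrm{DynQF}$ is the class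 of queries maintainable this way; unary $\mathrm{DynQF}$ requires all auxiliary relations and functions to have arity at most $1$. *)

theory Defs
  imports Main "HOL-Library.NList"
begin

text \<open>
  Databases are finite structures whose domain is a finite nonempty set of natural numbers; up to
  isomorphism these are all finite structures. An input schema is given by finite types
  \<^typ>\<open>'i\<close> of relation symbols and \<^typ>\<open>'c\<close> of constant symbols together with an arity
  function on \<^typ>\<open>'i\<close>. Auxiliary symbols are named by natural numbers. The set of \<open>k\<close>-tuples over
  \<open>D\<close> is \<^term>\<open>nlists k D\<close>.
\<close>

record ('i, 'c) database =
  dom :: "nat set"
  irel :: "'i \<Rightarrow> nat list set"
  const :: "'c \<Rightarrow> nat"

definition wf_database :: "('i \<Rightarrow> nat) \<Rightarrow> ('i, 'c) database \<Rightarrow> bool" where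
  "wf_database ar D \<longleftrightarrow>
     finite (dom D) \<and> dom D \<noteq> {} \<and>
     (\<forall>R. irel D R \<subseteq> nlists (ar R) (dom D)) \<and>
     (\<forall>c. const D c \<in> dom D)"

record aux_schema =
  rel_syms :: "nat set"
  fun_syms :: "nat set"
  rel_arity :: "nat \<Rightarrow> nat"
  fun_arity :: "nat \<Rightarrow> nat"

record aux_structure =
  arel :: "nat \<Rightarrow> nat list set"
  afun :: "nat \<Rightarrow> nat list \<Rightarrow> nat"

definition wf_aux_structure :: "aux_schema \<Rightarrow> nat set \<Rightarrow> aux_structure \<Rightarrow> bool" where
  "wf_aux_structure \<sigma> A X \<longleftrightarrow>
     (\<forall>R \<in> rel_syms \<sigma>. arel X R \<subseteq> nlists (rel_arity \<sigma> R) A) \<and>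
     (\<forall>f \<in> fun_syms \<sigma>. \<forall>b \<in> nlists (fun_arity \<sigma> f) A. afun X f b \<in> A)"

datatype 'i modification = Ins 'i | Del 'i

primrec mod_sym :: "'i modification \<Rightarrow> 'i" where
  "mod_sym (Ins R) = R"
| "mod_sym (Del R) = R"

text \<open>
  In an update formula or term with free variables \<open>(x; y)\<close>, \<open>XVar k\<close> refers to the
  \<open>k\<close>-th component of the modified tuple \<open>x\<close> and \<open>YVar k\<close> to the \<open>k\<close>-th component of the tuple \<open>y\<close>
  at which the auxiliary relation or function is redefined, both counted from \<open>0\<close>.
\<close>

datatype ('i, 'c) upd_term =
    XVar nat
  | YVar nat
  | Const 'c
  | App nat "('i, 'c) upd_term list"
  | Ite "('i, 'c) qf_formula" "('i, 'c) upd_term" "('i, 'c) upd_term"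
and ('i, 'c) qf_formula =
    Top
  | Eq "('i, 'c) upd_term" "('i, 'c) upd_term"
  | InRel 'i "('i, 'c) upd_term list"
  | AuxRel nat "('i, 'c) upd_term list"
  | Neg "('i, 'c) qf_formula"
  | Conj "('i, 'c) qf_formula" "('i, 'c) qf_formula"
  | Disj "('i, 'c) qf_formula" "('i, 'c) qf_formula"

text \<open>Arities are respected, and the variables are among \<open>x\<^sub>0, \<dots>, x\<^sub>m\<^sub>-\<^sub>1; y\<^sub>0, \<dots>, y\<^sub>n\<^sub>-\<^sub>1\<close>.\<close>

primrec
  wf_term :: "('i \<Rightarrow> nat) \<Rightarrow> aux_schema \<Rightarrow> nat \<Rightarrow> nat \<Rightarrow> ('i, 'c) upd_term \<Rightarrow> bool" and
  wf_formula :: "('i \<Rightarrow> nat) \<Rightarrow> aux_schema \<Rightarrow> nat \<Rightarrow> nat \<Rightarrow> ('i, 'c) qf_formula \<Rightarrow> bool"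
where
  "wf_term ar \<sigma> m n (XVar k) \<longleftrightarrow> k < m"
| "wf_term ar \<sigma> m n (YVar k) \<longleftrightarrow> k < n"
| "wf_term ar \<sigma> m n (Const c) \<longleftrightarrow> True"
| "wf_term ar \<sigma> m n (App f ts) \<longleftrightarrow>
     f \<in> fun_syms \<sigma> \<and> length ts = fun_arity \<sigma> f \<and> list_all (wf_term ar \<sigma> m n) ts"
| "wf_term ar \<sigma> m n (Ite \<phi> t u) \<longleftrightarrow>
     wf_formula ar \<sigma> m n \<phi> \<and> wf_term ar \<sigma> m n t \<and> wf_term ar \<sigma> m n u"
| "wf_formula ar \<sigma> m n Top \<longleftrightarrow> True"
| "wf_formula ar \<sigma> m n (Eq t u) \<longleftrightarrow> wf_term ar \<sigma> m n t \<and> wf_term ar \<sigma> m n u"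
| "wf_formula ar \<sigma> m n (InRel R ts) \<longleftrightarrow>
     length ts = ar R \<and> list_all (wf_term ar \<sigma> m n) ts"
| "wf_formula ar \<sigma> m n (AuxRel R ts) \<longleftrightarrow>
     R \<in> rel_syms \<sigma> \<and> length ts = rel_arity \<sigma> R \<and> list_all (wf_term ar \<sigma> m n) ts"
| "wf_formula ar \<sigma> m n (Neg \<phi>) \<longleftrightarrow> wf_formula ar \<sigma> m n \<phi>"
| "wf_formula ar \<sigma> m n (Conj \<phi> \<psi>) \<longleftrightarrow> wf_formula ar \<sigma> m n \<phi> \<and> wf_formula ar \<sigma> m n \<psi>"
| "wf_formula ar \<sigma> m n (Disj \<phi> \<psi>) \<longleftrightarrow> wf_formula ar \<sigma> m n \<phi> \<and> wf_formula ar \<sigma> m n \<psi>"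

primrec
  eval :: "('i, 'c) database \<Rightarrow> aux_structure \<Rightarrow> nat list \<Rightarrow> nat list \<Rightarrow> ('i, 'c) upd_term \<Rightarrow> nat" and
  sat :: "('i, 'c) database \<Rightarrow> aux_structure \<Rightarrow> nat list \<Rightarrow> nat list \<Rightarrow> ('i, 'c) qf_formula \<Rightarrow> bool"
where
  "eval D X a b (XVar k) = a ! k"
| "eval D X a b (YVar k) = b ! k"
| "eval D X a b (Const c) = const D c"
| "eval D X a b (App f ts) = afun X f (map (eval D X a b) ts)"
| "eval D X a b (Ite \<phi> t u) = (if sat D X a b \<phi> then eval D X a b t else eval D X a b u)"
| "sat D X a b Top \<longleftrightarrow> True"
| "sat D X a b (Eq t u) \<longleftrightarrow> eval D X a b t = eval D X a b u"
| "sat D X a b (InRel R ts) \<longleftrightarrow> map (eval D X a b) ts \<in> irel D R"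
| "sat D X a b (AuxRel R ts) \<longleftrightarrow> map (eval D X a b) ts \<in> arel X R"
| "sat D X a b (Neg \<phi>) \<longleftrightarrow> \<not> sat D X a b \<phi>"
| "sat D X a b (Conj \<phi> \<psi>) \<longleftrightarrow> sat D X a b \<phi> \<and> sat D X a b \<psi>"
| "sat D X a b (Disj \<phi> \<psi>) \<longleftrightarrow> sat D X a b \<phi> \<or> sat D X a b \<psi>"

record ('i, 'c) dyn_program =
  schema :: aux_schema
  upd_rel :: "nat \<Rightarrow> 'i modification \<Rightarrow> ('i, 'c) qf_formula"
  upd_fun :: "nat \<Rightarrow> 'i modification \<Rightarrow> ('i, 'c) upd_term"
  init :: "('i, 'c) database \<Rightarrow> aux_structure"
  query_sym :: nat

definition wf_program :: "('i \<Rightarrow> nat) \<Rightarrow> ('i, 'c) dyn_program \<Rightarrow> bool" where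
  "wf_program ar P \<longleftrightarrow>
     finite (rel_syms (schema P)) \<and> finite (fun_syms (schema P)) \<and>
     query_sym P \<in> rel_syms (schema P) \<and>
     (\<forall>R \<in> rel_syms (schema P). \<forall>\<delta>.
        wf_formula ar (schema P) (ar (mod_sym \<delta>)) (rel_arity (schema P) R) (upd_rel P R \<delta>)) \<and>
     (\<forall>f \<in> fun_syms (schema P). \<forall>\<delta>.
        wf_term ar (schema P) (ar (mod_sym \<delta>)) (fun_arity (schema P) f) (upd_fun P f \<delta>)) \<and>
     (\<forall>D. wf_database ar D \<longrightarrow> wf_aux_structure (schema P) (dom D) (init P D))"

fun modify :: "'i modification \<times> nat list \<Rightarrow> ('i, 'c) database \<Rightarrow> ('i, 'c) database" where
  "modify (Ins R, a) D = D\<lparr>irel := (irel D)(R := insert a (irel D R))\<rparr>"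
| "modify (Del R, a) D = D\<lparr>irel := (irel D)(R := irel D R - {a})\<rparr>"

definition valid_modification ::
    "('i \<Rightarrow> nat) \<Rightarrow> nat set \<Rightarrow> 'i modification \<times> nat list \<Rightarrow> bool" where
  "valid_modification ar A m \<longleftrightarrow> snd m \<in> nlists (ar (mod_sym (fst m))) A"

fun update ::
    "('i, 'c) dyn_program \<Rightarrow> 'i modification \<times> nat list \<Rightarrow> ('i, 'c) database \<Rightarrow> aux_structure
      \<Rightarrow> aux_structure" where
  "update P (\<delta>, a) D X =
     \<lparr>arel = (\<lambda>R. {b \<in> nlists (rel_arity (schema P) R) (dom D). sat D X a b (upd_rel P R \<delta>)}),
      afun = (\<lambda>f b. eval D X a b (upd_fun P f \<delta>))\<rparr>"

fun step ::
    "('i, 'c) dyn_program \<Rightarrow> 'i modification \<times> nat list \<Rightarrow> ('i, 'c) database \<times> aux_structure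
      \<Rightarrow> ('i, 'c) database \<times> aux_structure" where
  "step P m (D, X) = (modify m D, update P m D X)"

text \<open>A \<open>k\<close>-ary query; Boolean queries have \<open>k = 0\<close> and answer \<open>{[]}\<close> (true) or \<open>{}\<close> (false).\<close>

record ('i, 'c) query =
  in_arity :: "'i \<Rightarrow> nat"
  out_arity :: nat
  answer :: "('i, 'c) database \<Rightarrow> nat list set"

definition maintains :: "('i, 'c) dyn_program \<Rightarrow> ('i, 'c) query \<Rightarrow> bool" where
  "maintains P q \<longleftrightarrow>
     rel_arity (schema P) (query_sym P) = out_arity q \<and>
     (\<forall>D \<alpha>. wf_database (in_arity q) D \<longrightarrow>
        (\<forall>m \<in> set \<alpha>. valid_modification (in_arity q) (dom D) m) \<longrightarrow>
        arel (snd (fold (step P) \<alpha> (D, init P D))) (query_sym P) = answer q (fold modify \<alpha> D))"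

definition DynQF :: "('i::finite, 'c::finite) query set" where
  "DynQF = {q. \<exists>P. wf_program (in_arity q) P \<and> maintains P q}"

definition unary_schema :: "aux_schema \<Rightarrow> bool" where
  "unary_schema \<sigma> \<longleftrightarrow>
     (\<forall>R \<in> rel_syms \<sigma>. rel_arity \<sigma> R \<le> 1) \<and> (\<forall>f \<in> fun_syms \<sigma>. fun_arity \<sigma> f \<le> 1)"

definition unary_DynQF :: "('i::finite, 'c::finite) query set" where
  "unary_DynQF =
     {q. \<exists>P. wf_program (in_arity q) P \<and> unary_schema (schema P) \<and> maintains P q}"

datatype st_rel = E
datatype st_const = s | t

instance st_rel :: finite
proof
  have "(UNIV :: st_rel set) = {E}" using st_rel.exhaust by auto
  then show "finite (UNIV :: st_rel set)" by (metis finite.emptyI finite_insert)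
qed

instance st_const :: finite
proof
  have "(UNIV :: st_const set) = {s, t}" using st_const.exhaust by auto
  then show "finite (UNIV :: st_const set)" by (metis finite.emptyI finite_insert)
qed

definition st_reachability :: "(st_rel, st_const) query" where
  "st_reachability =
     \<lparr>in_arity = (\<lambda>_. 2),
      out_arity = 0,
      answer = (\<lambda>D. if (const D s, const D t) \<in> {(u, v). [u, v] \<in> irel D E}\<^sup>* then {[]} else {})\<rparr>"

hide_const (open) E s t

end

theory Submission
  imports Defs
begin

text \<open>
  For a set \<open>R\<close> of pairs of indices below \<open>n\<close>, take the graph with edges \<open>a\<^sub>i \<rightarrow> m\<^sub>i\<^sub>j\<close> for all
  \<open>i, j\<close> and \<open>m\<^sub>i\<^sub>j \<rightarrow> b\<^sub>j\<close> for \<open>(i, j) \<in> R\<close>. Inserting \<open>(s, a\<^sub>i)\<close> and \<open>(b\<^sub>j, t)\<close> makes \<open>t\<close> reachable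
  iff \<open>(i, j) \<in> R\<close>, so the initial auxiliary data must reveal \<open>R\<close>. But quantifier-free updates look,
  in boundedly many steps, only at elements obtained from \<open>s, t, a\<^sub>i, b\<^sub>j\<close> by boundedly many function
  applications. As all functions are unary, for all \<open>i, j\<close> together these are only \<open>O(n)\<close>
  elements. Every edge has an endpoint \<open>m\<^sub>i\<^sub>j\<close>, so the input and the auxiliary data on them
  are described by \<open>O(n)\<close> elements of a domain of size \<open>O(n\<^sup>2)\<close>. That leaves \<open>2\<^bsup>O(n log n)\<^esup>\<close>
  possibilities, fewer than the \<open>2\<^bsup>n\<^sup>2\<^esup>\<close> choices of \<open>R\<close>.
\<close>

declare nlistsE_length [simp del] nlistsE_set [simp del]

section \<open>Locality: what quantifier-free updates can see\<close>

text \<open>A bound on the nesting of function applications. Sums replace maxima: only some bound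
  per program matters, and the depth of each part is at most that of the whole.\<close>

primrec
  depth :: "('i, 'c) upd_term \<Rightarrow> nat" and
  fdepth :: "('i, 'c) qf_formula \<Rightarrow> nat"
where
  "depth (XVar k) = 0"
| "depth (YVar k) = 0"
| "depth (Const c) = 0"
| "depth (App f ts) = Suc (sum_list (map depth ts))"
| "depth (Ite \<phi> t u) = fdepth \<phi> + depth t + depth u"
| "fdepth Top = 0"
| "fdepth (Eq t u) = depth t + depth u"
| "fdepth (InRel R ts) = sum_list (map depth ts)"
| "fdepth (AuxRel R ts) = sum_list (map depth ts)"
| "fdepth (Neg \<phi>) = fdepth \<phi>"
| "fdepth (Conj \<phi> \<psi>) = fdepth \<phi> + fdepth \<psi>"
| "fdepth (Disj \<phi> \<psi>) = fdepth \<phi> + fdepth \<psi>"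

primrec hull :: "aux_schema \<Rightarrow> aux_structure \<Rightarrow> nat \<Rightarrow> nat set \<Rightarrow> nat set" where
  "hull \<sigma> X 0 S = S"
| "hull \<sigma> X (Suc k) S = hull \<sigma> X k S \<union>
     (\<Union>f \<in> fun_syms \<sigma>. afun X f ` nlists (fun_arity \<sigma> f) (hull \<sigma> X k S))"

lemma hull_add: "hull \<sigma> X (j + k) S = hull \<sigma> X k (hull \<sigma> X j S)"
  by (induction k) auto

lemma hull_mono_depth: "j \<le> k \<Longrightarrow> hull \<sigma> X j S \<subseteq> hull \<sigma> X k S"
  by (induction k) (auto simp: le_Suc_eq)

lemma hull_superset: "S \<subseteq> hull \<sigma> X k S"
  using hull_mono_depth[of 0 k] by simp

text \<open>Function values may lie outside \<open>W\<close>; they are compared as numbers, not up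
  to isomorphism, so that applying update terms to them again makes sense.\<close>

definition agree_on ::
    "aux_schema \<Rightarrow> nat set \<Rightarrow> ('i, 'c) database \<times> aux_structure \<Rightarrow>
     ('i, 'c) database \<times> aux_structure \<Rightarrow> bool" where
  "agree_on \<sigma> W S S' \<longleftrightarrow>
     dom (fst S) = dom (fst S') \<and> const (fst S) = const (fst S') \<and>
     (\<forall>R. \<forall>xs \<in> lists W. xs \<in> irel (fst S) R \<longleftrightarrow> xs \<in> irel (fst S') R) \<and>
     (\<forall>R \<in> rel_syms \<sigma>. \<forall>xs \<in> nlists (rel_arity \<sigma> R) W.
        xs \<in> arel (snd S) R \<longleftrightarrow> xs \<in> arel (snd S') R) \<and>
     (\<forall>f \<in> fun_syms \<sigma>. \<forall>xs \<in> nlists (fun_arity \<sigma> f) W. afun (snd S) f xs = afun (snd S') f xs)"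

lemma agree_on_mono: "agree_on \<sigma> W S S' \<Longrightarrow> V \<subseteq> W \<Longrightarrow> agree_on \<sigma> V S S'"
  unfolding agree_on_def by (meson lists_mono nlists_mono subsetD)

text \<open>The claim on values also locates them: a term of depth \<open>j\<close> evaluates into
  the hull of depth \<open>j\<close>. Hence the arguments of each application lie where the two
  states agree.\<close>

lemma eval_sat_agree:
  fixes v :: "('i, 'c) upd_term" and \<phi> :: "('i, 'c) qf_formula"
  assumes agree: "agree_on \<sigma> (hull \<sigma> X k S) (D, X) (D', X')"
    and S: "set a \<subseteq> S" "set b \<subseteq> S" "range (const D) \<subseteq> S"
  shows "wf_term ar \<sigma> (length a) (length b) v \<Longrightarrow> depth v \<le> k \<Longrightarrow>
           eval D X a b v \<in> hull \<sigma> X (depth v) S \<and> eval D' X' a b v = eval D X a b v"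
    and "wf_formula ar \<sigma> (length a) (length b) \<phi> \<Longrightarrow> fdepth \<phi> \<le> k \<Longrightarrow>
           sat D' X' a b \<phi> = sat D X a b \<phi>"
proof (induction v and \<phi>)
  case (XVar i)
  then show ?case using S by auto
next
  case (YVar i)
  then show ?case using S by auto
next
  case (Const c)
  then show ?case using S agree by (auto simp: agree_on_def)
next
  case (App f ts)
  have eq: "map (eval D' X' a b) ts = map (eval D X a b) ts"
    and sub: "set (map (eval D X a b) ts) \<subseteq> hull \<sigma> X (sum_list (map depth ts)) S"
  proof -
    have *: "eval D X a b v \<in> hull \<sigma> X (sum_list (map depth ts)) S \<and>
        eval D' X' a b v = eval D X a b v" if v: "v \<in> set ts" for v
    proof -
      have "depth v \<le> sum_list (map depth ts)" using v by (simp add: member_le_sum_list)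
      then show ?thesis
        using App.IH[OF v] App.prems v hull_mono_depth by (fastforce simp: list_all_iff)
    qed
    show "map (eval D' X' a b) ts = map (eval D X a b) ts" using * by simp
    show "set (map (eval D X a b) ts) \<subseteq> hull \<sigma> X (sum_list (map depth ts)) S" using * by auto
  qed
  have arg: "map (eval D X a b) ts \<in> nlists (fun_arity \<sigma> f) (hull \<sigma> X (sum_list (map depth ts)) S)"
    using App.prems by (intro nlistsI sub) simp
  moreover have "hull \<sigma> X (sum_list (map depth ts)) S \<subseteq> hull \<sigma> X k S"
    using App.prems by (intro hull_mono_depth) simp
  ultimately have "map (eval D X a b) ts \<in> nlists (fun_arity \<sigma> f) (hull \<sigma> X k S)"
    using nlists_mono by blast
  then have "afun X' f (map (eval D X a b) ts) = afun X f (map (eval D X a b) ts)"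
    using agree App.prems by (simp add: agree_on_def)
  moreover have "afun X f (map (eval D X a b) ts) \<in> hull \<sigma> X (depth (App f ts)) S"
    using arg App.prems by auto
  ultimately show ?case by (simp only: eval.simps eq simp_thms)
next
  case (Ite \<phi> u w)
  have "hull \<sigma> X (depth u) S \<subseteq> hull \<sigma> X (depth (Ite \<phi> u w)) S"
    "hull \<sigma> X (depth w) S \<subseteq> hull \<sigma> X (depth (Ite \<phi> u w)) S"
    by (intro hull_mono_depth, simp)+
  with Ite show ?case by auto
next
  case (InRel R ts)
  have *: "eval D X a b v \<in> hull \<sigma> X k S \<and> eval D' X' a b v = eval D X a b v"
    if v: "v \<in> set ts" for v
  proof -
    have "depth v \<le> sum_list (map depth ts)" using v by (simp add: member_le_sum_list)
    then have "depth v \<le> k" using InRel.prems by simp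
    then show ?thesis
      using InRel.IH[OF v] InRel.prems v hull_mono_depth[of "depth v" k \<sigma> X S]
      by (auto simp: list_all_iff)
  qed
  then have "map (eval D' X' a b) ts = map (eval D X a b) ts"
    "map (eval D X a b) ts \<in> lists (hull \<sigma> X k S)" by auto
  then show ?case using agree by (simp add: agree_on_def del: map_eq_conv)
next
  case (AuxRel R ts)
  have *: "eval D X a b v \<in> hull \<sigma> X k S \<and> eval D' X' a b v = eval D X a b v"
    if v: "v \<in> set ts" for v
  proof -
    have "depth v \<le> sum_list (map depth ts)" using v by (simp add: member_le_sum_list)
    then have "depth v \<le> k" using AuxRel.prems by simp
    then show ?thesis
      using AuxRel.IH[OF v] AuxRel.prems v hull_mono_depth[of "depth v" k \<sigma> X S]
      by (auto simp: list_all_iff)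
  qed
  then have "map (eval D' X' a b) ts = map (eval D X a b) ts"
    "map (eval D X a b) ts \<in> nlists (rel_arity \<sigma> R) (hull \<sigma> X k S)"
    using AuxRel.prems by (auto simp: nlists_def)
  then show ?case using agree AuxRel.prems by (simp add: agree_on_def del: map_eq_conv)
qed auto

definition depth_bound :: "('i, 'c) dyn_program \<Rightarrow> nat \<Rightarrow> bool" where
  "depth_bound P d \<longleftrightarrow>
     (\<forall>R \<in> rel_syms (schema P). \<forall>\<delta>. fdepth (upd_rel P R \<delta>) \<le> d) \<and>
     (\<forall>f \<in> fun_syms (schema P). \<forall>\<delta>. depth (upd_fun P f \<delta>) \<le> d)"

lemma finite_modification: "finite (UNIV :: 'i::finite modification set)"
proof -
  have "(UNIV :: 'i modification set) = range Ins \<union> range Del"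
    using modification.exhaust by (metis (no_types, lifting) UNIV_eq_I Un_iff rangeI)
  then show ?thesis by (metis finite finite_Un finite_imageI)
qed

lemma ex_depth_bound:
  fixes P :: "('i::finite, 'c) dyn_program"
  assumes "wf_program ar P"
  shows "\<exists>d. depth_bound P d"
proof -
  let ?A = "(\<lambda>(R, \<delta>). fdepth (upd_rel P R \<delta>)) ` (rel_syms (schema P) \<times> UNIV) \<union>
            (\<lambda>(f, \<delta>). depth (upd_fun P f \<delta>)) ` (fun_syms (schema P) \<times> UNIV)"
  have "finite ?A"
    using assms finite_modification[where 'i = 'i] by (simp add: wf_program_def)
  then have "\<forall>x \<in> ?A. x \<le> Max ?A" by simp
  then show ?thesis unfolding depth_bound_def by (intro exI[of _ "Max ?A"]) fastforce
qed

lemma dom_modify [simp]: "dom (modify m D) = dom D"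
  by (cases "(m, D)" rule: modify.cases) auto

lemma const_modify [simp]: "const (modify m D) = const D"
  by (cases "(m, D)" rule: modify.cases) auto

text \<open>Each new function is an old term of depth at most \<open>d\<close>, so \<open>k\<close>
  rounds of new functions stay within \<open>k * d\<close> rounds of old ones. The further
  \<open>d\<close> rounds pay for evaluating the update terms and formulas there.\<close>

lemma agree_on_step:
  assumes wf: "wf_program ar P" and d: "depth_bound P d"
    and len: "length a = ar (mod_sym \<delta>)"
    and S: "set a \<subseteq> S" "range (const D) \<subseteq> S"
    and agree: "agree_on (schema P) (hull (schema P) X (k * d + d) S) (D, X) (D', X')"
  shows "agree_on (schema P) (hull (schema P) (update P (\<delta>, a) D X) k S)
           (step P (\<delta>, a) (D, X)) (step P (\<delta>, a) (D', X'))"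
proof -
  let ?\<sigma> = "schema P" and ?X = "update P (\<delta>, a) D X"
  let ?H = "\<lambda>j. hull ?\<sigma> X (j * d) S"
  have SH: "S \<subseteq> ?H j" for j by (rule hull_superset)
  have agreeH: "agree_on ?\<sigma> (hull ?\<sigma> X d (?H j)) (D, X) (D', X')" if "j \<le> k" for j
    using agree_on_mono[OF agree] hull_mono_depth[of "j * d + d" "k * d + d"] that
    by (simp add: hull_add[symmetric])
  have funs: "afun ?X f xs \<in> hull ?\<sigma> X d (?H j) \<and> eval D' X' a xs (upd_fun P f \<delta>) = afun ?X f xs"
    if "j \<le> k" "f \<in> fun_syms ?\<sigma>" "xs \<in> nlists (fun_arity ?\<sigma> f) (?H j)" for j f xs
  proof -
    have "depth (upd_fun P f \<delta>) \<le> d" using d that by (auto simp: depth_bound_def)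
    moreover have "length xs = fun_arity ?\<sigma> f" and xs: "set xs \<subseteq> ?H j"
      using that by (simp_all add: nlists_def)
    then have "wf_term ar ?\<sigma> (length a) (length xs) (upd_fun P f \<delta>)"
      using wf that len by (simp add: wf_program_def)
    moreover have "set a \<subseteq> ?H j" "range (const D) \<subseteq> ?H j" using S SH[of j] by blast+
    ultimately show ?thesis
      using eval_sat_agree(1)[OF agreeH[OF that(1)] _ xs, of a ar "upd_fun P f \<delta>"]
        hull_mono_depth[of "depth (upd_fun P f \<delta>)" d ?\<sigma> X "?H j"]
      by auto
  qed
  \<comment> \<open>One round of the updated functions costs at most \<open>d\<close> rounds of the
    old ones.\<close>
  have sub: "hull ?\<sigma> ?X j S \<subseteq> ?H j" if "j \<le> k" for j
    using that
  proof (induction j)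
    case (Suc j)
    have "afun ?X f xs \<in> ?H (Suc j)"
      if "f \<in> fun_syms ?\<sigma>" "xs \<in> nlists (fun_arity ?\<sigma> f) (hull ?\<sigma> ?X j S)" for f xs
    proof -
      have "xs \<in> nlists (fun_arity ?\<sigma> f) (?H j)" using that Suc by (auto simp: nlists_def)
      then show ?thesis
        using funs[of j f xs] Suc.prems that
        by (simp add: hull_add[symmetric] add.commute del: update.simps)
    qed
    moreover have "?H j \<subseteq> ?H (Suc j)" by (intro hull_mono_depth) simp
    ultimately show ?case using Suc by (auto simp del: update.simps)
  qed simp
  have rels: "sat D' X' a xs (upd_rel P R \<delta>) = sat D X a xs (upd_rel P R \<delta>)"
    if "R \<in> rel_syms ?\<sigma>" "xs \<in> nlists (rel_arity ?\<sigma> R) (?H k)" for R xs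
  proof -
    have "fdepth (upd_rel P R \<delta>) \<le> d" using d that by (auto simp: depth_bound_def)
    moreover have "length xs = rel_arity ?\<sigma> R" and xs: "set xs \<subseteq> ?H k"
      using that by (simp_all add: nlists_def)
    then have "wf_formula ar ?\<sigma> (length a) (length xs) (upd_rel P R \<delta>)"
      using wf that len by (simp add: wf_program_def)
    moreover have "set a \<subseteq> ?H k" "range (const D) \<subseteq> ?H k" using S SH[of k] by blast+
    ultimately show ?thesis
      using eval_sat_agree(2)[OF agreeH[OF order_refl] _ xs, of a ar "upd_rel P R \<delta>"] by blast
  qed
  have in_rel: "xs \<in> irel (modify (\<delta>, a) D) R \<longleftrightarrow> xs \<in> irel (modify (\<delta>, a) D') R"
    if "xs \<in> lists (?H k)" for R xs
  proof -
    have "xs \<in> lists (hull ?\<sigma> X (k * d + d) S)"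
      using that hull_mono_depth[of "k * d" "k * d + d" ?\<sigma> X S] lists_mono by fastforce
    then show ?thesis using agree by (cases \<delta>) (auto simp: agree_on_def)
  qed
  have "agree_on ?\<sigma> (?H k) (step P (\<delta>, a) (D, X)) (step P (\<delta>, a) (D', X'))"
    unfolding agree_on_def
    using agree rels funs[OF order_refl] in_rel by (auto simp: agree_on_def)
  then show ?thesis using agree_on_mono sub by blast
qed

section \<open>Hulls over unary schemas grow linearly\<close>

text \<open>Arity at most one is decisive: the image of a set under each function symbol is no
  larger than the set, so a round multiplies the size by at most a constant.\<close>

lemma card_hull:
  assumes "unary_schema \<sigma>" "finite (fun_syms \<sigma>)" "finite S" "S \<noteq> {}"
  shows "finite (hull \<sigma> X k S) \<and> card (hull \<sigma> X k S) \<le> (1 + card (fun_syms \<sigma>)) ^ k * card S"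
proof (induction k)
  case 0
  then show ?case using assms by simp
next
  case (Suc k)
  let ?H = "hull \<sigma> X k S"
  have ne: "?H \<noteq> {}" using hull_superset assms(4) by blast
  have im: "finite (afun X f ` nlists (fun_arity \<sigma> f) ?H) \<and>
      card (afun X f ` nlists (fun_arity \<sigma> f) ?H) \<le> card ?H" if "f \<in> fun_syms \<sigma>" for f
  proof -
    have "finite (nlists (fun_arity \<sigma> f) ?H)"
      and "card (nlists (fun_arity \<sigma> f) ?H) = card ?H ^ fun_arity \<sigma> f"
      using Suc finite_lists_length_eq[of ?H "fun_arity \<sigma> f"] card_lists_length_eq[of ?H "fun_arity \<sigma> f"]
      by (simp_all add: nlists_def conj_commute)
    \<comment> \<open>For a nullary symbol the left side is 1, which is why the hull must be
      nonempty.\<close>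
    moreover have "card ?H ^ fun_arity \<sigma> f \<le> card ?H"
    proof -
      have "fun_arity \<sigma> f \<le> 1" using that assms by (simp add: unary_schema_def)
      moreover have "card ?H \<ge> 1" using ne Suc by (simp add: Suc_le_eq card_gt_0_iff)
      ultimately show ?thesis using power_increasing[of "fun_arity \<sigma> f" 1 "card ?H"] by simp
    qed
    ultimately show ?thesis by (metis card_image_le finite_imageI order_trans)
  qed
  have "card (\<Union>f \<in> fun_syms \<sigma>. afun X f ` nlists (fun_arity \<sigma> f) ?H)
      \<le> (\<Sum>f \<in> fun_syms \<sigma>. card (afun X f ` nlists (fun_arity \<sigma> f) ?H))"
    by (rule card_UN_le[OF assms(2)])
  also have "\<dots> \<le> card (fun_syms \<sigma>) * card ?H"
    using sum_mono[of "fun_syms \<sigma>" _ "\<lambda>_. card ?H"] im by simp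
  finally have "card (hull \<sigma> X (Suc k) S) \<le> card ?H + card (fun_syms \<sigma>) * card ?H"
    using card_Un_le[of ?H "\<Union>f \<in> fun_syms \<sigma>. afun X f ` nlists (fun_arity \<sigma> f) ?H"] by simp
  also have "\<dots> = (1 + card (fun_syms \<sigma>)) * card ?H" by simp
  also have "\<dots> \<le> (1 + card (fun_syms \<sigma>)) * ((1 + card (fun_syms \<sigma>)) ^ k * card S)"
    using Suc by (intro mult_le_mono2) simp
  finally have "card (hull \<sigma> X (Suc k) S) \<le> (1 + card (fun_syms \<sigma>)) ^ Suc k * card S"
    by (simp only: power_Suc mult.assoc)
  then show ?case using Suc im assms(2) by simp
qed

lemma hull_subset_dom:
  assumes "wf_aux_structure \<sigma> A X" "S \<subseteq> A"
  shows "hull \<sigma> X k S \<subseteq> A"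
proof (induction k)
  case (Suc k)
  then show ?case using assms by (fastforce simp: wf_aux_structure_def nlists_def)
qed (use assms in simp)

section \<open>The graphs coding a binary relation\<close>

text \<open>Row-major numbering of the index pairs, shifted past \<open>s\<close>, \<open>t\<close>
  and the two outer layers.\<close>

definition mid :: "nat \<Rightarrow> nat \<Rightarrow> nat \<Rightarrow> nat" where
  "mid n i j = 2 + 2 * n + i * n + j"

text \<open>Relations on indices are represented by subsets of this set. Membership of a pair
  thereby becomes a property of a single node.\<close>

definition mids :: "nat \<Rightarrow> nat set" where
  "mids n = (\<lambda>(i, j). mid n i j) ` ({..<n} \<times> {..<n})"

lemma mid_eq_iff:
  assumes "j < n" "j' < n"
  shows "mid n i j = mid n i' j' \<longleftrightarrow> i = i' \<and> j = j'"
proof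
  assume "mid n i j = mid n i' j'"
  then have eq: "i * n + j = i' * n + j'" by (simp add: mid_def)
  have "(i * n + j) div n = i" "(i * n + j) mod n = j"
    "(i' * n + j') div n = i'" "(i' * n + j') mod n = j'" using assms by simp_all
  with eq show "i = i' \<and> j = j'" by simp
qed simp

lemma mid_less: "i < n \<Longrightarrow> j < n \<Longrightarrow> mid n i j < 2 + 2 * n + n * n"
proof -
  assume "i < n" "j < n"
  have "i * n + j < Suc i * n" using \<open>j < n\<close> by simp
  also have "\<dots> \<le> n * n" using \<open>i < n\<close> by (intro mult_le_mono1) simp
  finally show ?thesis by (simp add: mid_def)
qed

lemma card_mids: "card (mids n) = n * n"
proof -
  have "inj_on (\<lambda>(i, j). mid n i j) ({..<n} \<times> {..<n})"
    by (auto simp: inj_on_def mid_eq_iff)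
  then show ?thesis by (simp add: mids_def card_image card_cartesian_product)
qed

text \<open>Node \<open>0\<close> is \<open>s\<close>, node \<open>1\<close> is \<open>t\<close>, the left layer is \<open>2 + i\<close> and the right layer \<open>2 + n + j\<close>.\<close>

definition gadget :: "nat \<Rightarrow> nat set \<Rightarrow> (st_rel, st_const) database" where
  "gadget n R =
     \<lparr>dom = {..<2 + 2 * n + n * n},
      irel = (\<lambda>_. {[2 + i, mid n i j] |i j. i < n \<and> j < n} \<union>
                  {[mid n i j, 2 + n + j] |i j. i < n \<and> j < n \<and> mid n i j \<in> R}),
      const = (\<lambda>c. case c of st_const.s \<Rightarrow> 0 | st_const.t \<Rightarrow> 1)\<rparr>"

lemma wf_gadget: "wf_database (\<lambda>_. 2) (gadget n R)"
proof -
  have "irel (gadget n R) r \<subseteq> nlists 2 (dom (gadget n R))" for r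
    using mid_less by (auto simp: gadget_def nlists_def)
  then show ?thesis
    by (auto simp: wf_database_def gadget_def split: st_const.splits)
qed

text \<open>Node 0 has only the edge to \<open>2 + i\<close>, node 1 only the edge from
  \<open>2 + n + j\<close>, and the only node that can link these two is
  \<open>mid n i j\<close>.\<close>

lemma answer_gadget:
  assumes ij: "i < n" "j < n"
  shows "answer st_reachability
           (modify (Ins st_rel.E, [2 + n + j, 1]) (modify (Ins st_rel.E, [0, 2 + i]) (gadget n R)))
         = (if mid n i j \<in> R then {[]} else {})"
proof -
  let ?D = "modify (Ins st_rel.E, [2 + n + j, 1]) (modify (Ins st_rel.E, [0, 2 + i]) (gadget n R))"
  let ?E = "{(u, v). [u, v] \<in> irel ?D st_rel.E}"
  have edges: "?E = {(0, 2 + i), (2 + n + j, 1)} \<union> {(2 + i, mid n i j) |i j. i < n \<and> j < n} \<union>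
      {(mid n i j, 2 + n + j) |i j. i < n \<and> j < n \<and> mid n i j \<in> R}"
    by (auto simp: gadget_def)
  have "(0, 1) \<in> ?E\<^sup>*" if "mid n i j \<in> R"
  proof -
    have "(0, 2 + i) \<in> ?E" "(2 + i, mid n i j) \<in> ?E" "(mid n i j, 2 + n + j) \<in> ?E"
      "(2 + n + j, 1) \<in> ?E" using ij that unfolding edges by blast+
    then show ?thesis by (meson r_into_rtrancl rtrancl_trans)
  qed
  moreover have "mid n i j \<in> R" if "(0, 1) \<in> ?E\<^sup>*"
  proof -
    let ?I = "{0, 2 + i} \<union> mid n i ` {..<n} \<union> {2 + n + j' |j'. j' < n \<and> mid n i j' \<in> R} \<union>
      {v. v = 1 \<and> mid n i j \<in> R}"
    have "v \<in> ?I" if "(0, v) \<in> ?E\<^sup>*" for v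
      using that
    proof (induction rule: rtrancl_induct)
      case (step u v)
      consider "u = 0" "v = 2 + i" | "u = 2 + n + j" "v = 1"
        | i' j' where "u = 2 + i'" "v = mid n i' j'" "i' < n" "j' < n"
        | i' j' where "u = mid n i' j'" "v = 2 + n + j'" "i' < n" "j' < n" "mid n i' j' \<in> R"
        using step.hyps(2) unfolding edges by blast
      then show ?case
      proof cases
        case 2
        then show ?thesis using step.IH ij by (auto simp: mid_def)
      next
        case 3
        then show ?thesis using step.IH ij by (auto simp: mid_def)
      next
        case 4
        then have "u \<in> mid n i ` {..<n}" using step.IH ij by (auto simp: mid_def)
        then show ?thesis using 4 by (auto simp: mid_eq_iff)
      qed simp
    qed simp
    then show ?thesis using that by (auto simp: mid_def)
  qed
  moreover have "const ?D st_const.s = 0" "const ?D st_const.t = 1" by (simp_all add: gadget_def)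
  moreover have "answer st_reachability ?D =
      (if (const ?D st_const.s, const ?D st_const.t) \<in> ?E\<^sup>* then {[]} else {})"
    by (simp only: st_reachability_def query.simps)
  ultimately show ?thesis by (metis (no_types, lifting))
qed

text \<open>The seed set holds both constants and both outer layers, hence the parameters of all
  insertions. One agreement assumption thus serves every pair of indices.\<close>

lemma agree_on_gadget_eq:
  assumes wf: "wf_program (\<lambda>_. 2) P" and d: "depth_bound P d"
    and P: "maintains P st_reachability"
    and R: "R \<subseteq> mids n" "R' \<subseteq> mids n"
    and agree: "agree_on (schema P)
      (hull (schema P) (init P (gadget n R)) (d * d + d) {..<2 + 2 * n})
      (gadget n R, init P (gadget n R)) (gadget n R', init P (gadget n R'))"
  shows "R = R'"
proof -
  let ?\<sigma> = "schema P" and ?S = "{..<2 + 2 * n}"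
  have "mid n i j \<in> R \<longleftrightarrow> mid n i j \<in> R'" if ij: "i < n" "j < n" for i j
  proof -
    let ?m = "(Ins st_rel.E, [0, 2 + i])" and ?m' = "(Ins st_rel.E, [2 + n + j, 1])"
    let ?st = "\<lambda>R. (gadget n R, init P (gadget n R))"
    let ?st1 = "\<lambda>R. step P ?m (?st R)"
    have cst: "range (const (gadget n R)) \<subseteq> ?S" by (auto simp: gadget_def split: st_const.splits)
    \<comment> \<open>The depths are chosen backwards: 0 suffices after the second insertion, so
      \<open>0 * d + d = d\<close> is needed after the first and \<open>d * d + d\<close>
      initially.\<close>
    have "agree_on ?\<sigma> (hull ?\<sigma> (snd (?st1 R)) d ?S) (?st1 R) (?st1 R')"
      using agree_on_step[OF wf d _ _ cst agree, of "[0, 2 + i]" "Ins st_rel.E"] ij by simp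
    then have "agree_on ?\<sigma> (hull ?\<sigma> (snd (step P ?m' (?st1 R))) 0 ?S)
        (step P ?m' (?st1 R)) (step P ?m' (?st1 R'))"
      using agree_on_step[OF wf d, where a = "[2 + n + j, 1]" and \<delta> = "Ins st_rel.E" and S = ?S
          and D = "fst (?st1 R)" and X = "snd (?st1 R)" and k = 0
          and D' = "fst (?st1 R')" and X' = "snd (?st1 R')"] ij cst
      by (simp del: update.simps modify.simps)
    \<comment> \<open>The query symbol is nullary, so agreement on any set at all fixes the
      answer.\<close>
    moreover have Q: "query_sym P \<in> rel_syms ?\<sigma>" "rel_arity ?\<sigma> (query_sym P) = 0"
      using wf P by (simp_all add: wf_program_def maintains_def st_reachability_def)
    ultimately have "[] \<in> arel (snd (step P ?m' (?st1 R))) (query_sym P) \<longleftrightarrow>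
        [] \<in> arel (snd (step P ?m' (?st1 R'))) (query_sym P)"
      unfolding agree_on_def by (metis nlists_n_0 singletonI)
    moreover have "arel (snd (step P ?m' (?st1 T))) (query_sym P) =
        (if mid n i j \<in> T then {[]} else {})" for T
    proof -
      have "valid_modification (\<lambda>_. 2) (dom (gadget n T)) m" if "m \<in> set [?m, ?m']" for m
        using that ij by (auto simp: valid_modification_def nlists_def gadget_def)
      moreover have "in_arity st_reachability = (\<lambda>_. 2)" by (simp add: st_reachability_def)
      ultimately have "arel (snd (fold (step P) [?m, ?m'] (?st T))) (query_sym P) =
          answer st_reachability (fold modify [?m, ?m'] (gadget n T))"
        using P wf_gadget[of n T] unfolding maintains_def by metis
      also have "\<dots> = (if mid n i j \<in> T then {[]} else {})"
        using answer_gadget[OF ij, of T] by (simp del: modify.simps)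
      finally show ?thesis by (simp del: step.simps)
    qed
    ultimately show ?thesis by (simp del: step.simps split: if_splits)
  qed
  then show ?thesis using R unfolding mids_def by auto
qed

section \<open>Coding a state on a hull by rows\<close>

text \<open>The argument list \<open>replicate k x\<close> covers arity \<open>0\<close> and arity \<open>1\<close> uniformly.\<close>

definition row :: "aux_schema \<Rightarrow> nat list \<Rightarrow> nat list \<Rightarrow> aux_structure \<Rightarrow> nat set \<Rightarrow> nat \<Rightarrow> nat list" where
  "row \<sigma> fs rs X R x =
     x # of_bool (x \<in> R) # map (\<lambda>f. afun X f (replicate (fun_arity \<sigma> f) x)) fs @
     map (\<lambda>r. of_bool (replicate (rel_arity \<sigma> r) x \<in> arel X r)) rs"

lemma nlists_le_1_replicate:
  assumes "k \<le> 1" "xs \<in> nlists k W" "W \<noteq> {}"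
  obtains x where "x \<in> W" "xs = replicate k x"
proof (cases k)
  case 0
  then show ?thesis using assms that by auto
next
  case (Suc k')
  then show ?thesis using assms that by (auto simp: in_nlists_Suc_iff)
qed

text \<open>Over a unary schema a row records all auxiliary data at its element, together with the
  bit for \<open>R\<close>; the input relation depends on nothing else.\<close>

lemma row_agree:
  assumes un: "unary_schema \<sigma>" and fs: "set fs = fun_syms \<sigma>" and rs: "set rs = rel_syms \<sigma>"
    and W: "W \<noteq> {}" and row: "\<And>x. x \<in> W \<Longrightarrow> row \<sigma> fs rs X R x = row \<sigma> fs rs X' R' x"
  shows "agree_on \<sigma> W (gadget n R, X) (gadget n R', X')"
proof -
  have R: "x \<in> R \<longleftrightarrow> x \<in> R'" if "x \<in> W" for x
    using row[OF that] by (auto simp: row_def of_bool_eq_iff)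
  have f: "afun X f xs = afun X' f xs"
    if f: "f \<in> fun_syms \<sigma>" and xs: "xs \<in> nlists (fun_arity \<sigma> f) W" for f xs
  proof -
    have "fun_arity \<sigma> f \<le> 1" using un f by (simp add: unary_schema_def)
    then obtain x where "x \<in> W" "xs = replicate (fun_arity \<sigma> f) x"
      using nlists_le_1_replicate xs W by metis
    then show ?thesis using row[of x] f fs by (auto simp: row_def)
  qed
  have r: "xs \<in> arel X r \<longleftrightarrow> xs \<in> arel X' r"
    if r: "r \<in> rel_syms \<sigma>" and xs: "xs \<in> nlists (rel_arity \<sigma> r) W" for r xs
  proof -
    have "rel_arity \<sigma> r \<le> 1" using un r by (simp add: unary_schema_def)
    then obtain x where "x \<in> W" "xs = replicate (rel_arity \<sigma> r) x"
      using nlists_le_1_replicate xs W by metis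
    then show ?thesis using row[of x] r rs by (auto simp: row_def of_bool_eq_iff)
  qed
  \<comment> \<open>Only edges leaving a middle node depend on \<open>R\<close>, and such an edge
    within \<open>W\<close> has that node in \<open>W\<close>, where the bits agree.\<close>
  have e: "xs \<in> irel (gadget n R) q \<longleftrightarrow> xs \<in> irel (gadget n R') q" if "xs \<in> lists W" for xs q
  proof -
    have "xs = [mid n i j, 2 + n + j] \<and> i < n \<and> j < n \<and> mid n i j \<in> R \<longleftrightarrow>
        xs = [mid n i j, 2 + n + j] \<and> i < n \<and> j < n \<and> mid n i j \<in> R'" for i j
      using that R by auto
    then show ?thesis by (simp add: gadget_def)
  qed
  show ?thesis using f r e by (simp add: agree_on_def) (simp add: gadget_def)
qed

text \<open>Repeating an element pads the list, so that hulls of different sizes get codes of the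
  same length.\<close>

lemma ex_enumeration:
  assumes "finite W" "W \<noteq> {}" "card W \<le> w"
  shows "\<exists>ws. length ws = w \<and> set ws = W"
proof -
  obtain xs where xs: "set xs = W" "length xs = card W"
    using assms(1) by (metis distinct_card finite_distinct_list)
  obtain x where "x \<in> W" using assms by blast
  then have "length (xs @ replicate (w - card W) x) = w \<and> set (xs @ replicate (w - card W) x) = W"
    using xs assms(3) by auto
  then show ?thesis by blast
qed

section \<open>Counting codes against relations\<close>

lemma ex_pow_gt_linear: "\<exists>j\<ge>2. (2 * j + 1) * D < (2::nat) ^ j"
proof -
  \<comment> \<open>With \<open>j = 2 * m\<close>, one factor \<open>2 ^ m\<close> absorbs
    \<open>m + 1\<close> and the other absorbs \<open>4 * D\<close>.\<close>
  define m where "m = 4 * D + 1"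
  have m: "m + 1 \<le> 2 ^ m" "4 * D < 2 ^ m"
    using less_exp[of m] by (simp_all add: m_def Suc_le_eq)
  have "(2 * (2 * m) + 1) * D \<le> (m + 1) * (4 * D)" by (simp add: algebra_simps)
  also have "\<dots> \<le> 2 ^ m * (4 * D)" using m(1) by (rule mult_le_mono1)
  also have "\<dots> < 2 ^ m * 2 ^ m" using m(2) by simp
  also have "\<dots> = 2 ^ (2 * m)" by (simp add: power_add[symmetric] mult_2)
  finally show ?thesis by (intro exI[of _ "2 * m"]) (simp add: m_def)
qed

lemma ex_code_bound: "\<exists>n. (2 + 2 * n + n * n) ^ (C * (2 + 2 * n)) < (2::nat) ^ (n * n)"
proof -
  obtain j where j: "j \<ge> 2" "(2 * j + 1) * (4 * C) < (2::nat) ^ j" using ex_pow_gt_linear by blast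
  \<comment> \<open>A power of two makes the base at most \<open>2 ^ (2 * j + 1)\<close>, so only
    exponents need comparing. After cancelling a factor \<open>n = 2 ^ j\<close>, the choice of
    \<open>j\<close> is exactly the inequality required.\<close>
  define n :: nat where "n = 2 ^ j"
  have n: "n \<ge> 4" using power_increasing[OF j(1), of "2::nat"] by (simp add: n_def)
  then have "4 * n \<le> n * n" by simp
  then have "2 + 2 * n + n * n \<le> 2 * (n * n)" using n by linarith
  also have "\<dots> = 2 ^ (2 * j + 1)" by (simp add: n_def power_add[symmetric] mult_2)
  finally have "(2 + 2 * n + n * n) ^ (C * (2 + 2 * n)) \<le> (2 ^ (2 * j + 1)) ^ (C * (2 + 2 * n))"
    by (rule power_mono) simp
  also have "\<dots> = 2 ^ ((2 * j + 1) * (C * (2 + 2 * n)))" by (rule power_mult[symmetric])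
  also have "\<dots> \<le> 2 ^ ((2 * j + 1) * (C * (4 * n)))"
    using n by (intro power_increasing mult_le_mono) simp_all
  also have "\<dots> < 2 ^ (n * n)"
  proof (rule power_strict_increasing)
    have "(2 * j + 1) * (C * (4 * n)) = (2 * j + 1) * (4 * C) * n" by (simp add: algebra_simps)
    also have "\<dots> < n * n" using j(2) n unfolding n_def[symmetric] by (intro mult_strict_right_mono) simp_all
    finally show "(2 * j + 1) * (C * (4 * n)) < n * n" .
  qed simp
  finally show ?thesis by blast
qed

theorem theorem5p7: "st_reachability \<notin> unary_DynQF"
proof
  assume "st_reachability \<in> unary_DynQF"
  then obtain P where wf: "wf_program (\<lambda>_. 2) P" and un: "unary_schema (schema P)"
    and P: "maintains P st_reachability"
    by (auto simp: unary_DynQF_def st_reachability_def)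
  let ?\<sigma> = "schema P"
  obtain d where d: "depth_bound P d" using ex_depth_bound[OF wf] by blast
  have fin: "finite (fun_syms ?\<sigma>)" "finite (rel_syms ?\<sigma>)" using wf by (simp_all add: wf_program_def)
  obtain fs rs where fs: "set fs = fun_syms ?\<sigma>" and rs: "set rs = rel_syms ?\<sigma>"
    using fin finite_list by metis
  \<comment> \<open>The constants \<open>K\<close>, \<open>c\<close>, \<open>L\<close> depend only
    on the program, so \<open>n\<close> can be chosen after them. \<open>K\<close> is the depth for
    two insertions, \<open>c\<close> the growth factor of the hull, and \<open>L\<close> the row
    length, with 2 for the element and its bit.\<close>
  define K where "K = d * d + d"
  define c where "c = (1 + card (fun_syms ?\<sigma>)) ^ K"
  define L where "L = 2 + length fs + length rs"
  obtain n where n: "(2 + 2 * n + n * n) ^ (L * c * (2 + 2 * n)) < (2::nat) ^ (n * n)"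
    using ex_code_bound by blast
  define V where "V = {..<2 + 2 * n + n * n}"
  define w where "w = c * (2 + 2 * n)"
  define X where "X = (\<lambda>R. init P (gadget n R))"
  define W where "W = (\<lambda>R. hull ?\<sigma> (X R) K {..<2 + 2 * n})"
  have X: "wf_aux_structure ?\<sigma> V (X R)" for R
  proof -
    have "wf_aux_structure ?\<sigma> (dom (gadget n R)) (X R)"
      using wf wf_gadget by (simp add: wf_program_def X_def)
    then show ?thesis by (simp add: V_def gadget_def)
  qed
  have WV: "W R \<subseteq> V" for R
    unfolding W_def by (rule hull_subset_dom[OF X]) (auto simp: V_def)
  have ne: "W R \<noteq> {}" for R
    using hull_superset[of "{..<2 + 2 * n}" ?\<sigma> "X R" K] by (auto simp: W_def)
  have "finite (W R)" "card (W R) \<le> w" for R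
    using card_hull[OF un fin(1), of "{..<2 + 2 * n}" "X R" K] by (auto simp: W_def w_def c_def)
  then have "\<forall>R. \<exists>ws. length ws = w \<and> set ws = W R" using ne by (intro allI ex_enumeration)
  then obtain ws where ws: "\<And>R. length (ws R) = w" "\<And>R. set (ws R) = W R" by metis
  define code where "code = (\<lambda>R. map (row ?\<sigma> fs rs (X R) R) (ws R))"
  have inj: "inj_on code (Pow (mids n))"
  proof (rule inj_onI)
    fix R R' assume R: "R \<in> Pow (mids n)" "R' \<in> Pow (mids n)" and eq: "code R = code R'"
    \<comment> \<open>Each row starts with its element, so equal codes enumerate the same hull in
      the same order and can be compared row by row.\<close>
    have "map hd (code R) = map hd (code R')" using eq by simp
    then have "ws R = ws R'" by (simp add: code_def row_def comp_def)
    then have "row ?\<sigma> fs rs (X R) R x = row ?\<sigma> fs rs (X R') R' x" if "x \<in> W R" for x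
      using eq that ws(2)[of R] by (auto simp: code_def)
    then have "agree_on ?\<sigma> (W R) (gadget n R, X R) (gadget n R', X R')"
      by (rule row_agree[OF un fs rs ne])
    then show "R = R'" using agree_on_gadget_eq[OF wf d P, of R n R'] R by (simp add: W_def X_def K_def)
  qed
  have row: "row ?\<sigma> fs rs (X R) R x \<in> nlists L V" if "x \<in> V" for R x
  proof -
    have "replicate k x \<in> nlists k V" for k using that by (auto simp: nlists_def)
    then have "afun (X R) f (replicate (fun_arity ?\<sigma> f) x) \<in> V" if "f \<in> set fs" for f
      using X[of R] that fs by (simp add: wf_aux_structure_def)
    \<comment> \<open>The bits 0 and 1 are themselves nodes, so all row entries come from the one
      alphabet \<open>V\<close>.\<close>
    moreover have "of_bool b \<in> V" for b by (cases b) (auto simp: V_def)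
    ultimately show ?thesis using that by (auto simp: row_def nlists_def L_def)
  qed
  have "code ` Pow (mids n) \<subseteq> nlists w (nlists L V)"
  proof (intro image_subsetI nlistsI)
    fix R
    show "length (code R) = w" by (simp add: code_def ws)
    show "set (code R) \<subseteq> nlists L V" using row WV[of R] by (auto simp: code_def ws)
  qed
  moreover have "finite (nlists L V)" "card (nlists L V) = card V ^ L"
    using finite_lists_length_eq[of V L] card_lists_length_eq[of V L]
    by (simp_all add: nlists_def conj_commute V_def)
  then have "finite (nlists w (nlists L V))" "card (nlists w (nlists L V)) = (card V ^ L) ^ w"
    using finite_lists_length_eq[of "nlists L V" w] card_lists_length_eq[of "nlists L V" w]
    by (simp_all add: nlists_def[of w] conj_commute)
  \<comment> \<open>Codes are words of length \<open>w\<close> whose letters are words of length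
    \<open>L\<close> over \<open>V\<close>; injectivity bounds the number of relations by the number
    of such words.\<close>
  ultimately have "card (Pow (mids n)) \<le> (card V ^ L) ^ w"
    using card_inj_on_le[OF inj] by metis
  moreover have "finite (mids n)" by (simp add: mids_def)
  ultimately have "2 ^ (n * n) \<le> (2 + 2 * n + n * n) ^ (L * c * (2 + 2 * n))"
    by (simp add: card_Pow card_mids V_def w_def power_mult[symmetric] algebra_simps)
  with n show False by simp
qed

end
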